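(* In any transition system $(\mathrm{Proc},\mathsf{Act},\rightarrow,\uparrow)$ satisfying (BN), for all $p,q\in\mathrm{Proc}$: $\mathrm{HML}^{+}(p)\subseteq\mathrm{HML}^{+}(q)\iff\mathcal{L}_\omega(p)\subseteq\mathcal{L}_\omega(q)$.
   Context: A transition system is $(\mathrm{Proc},\mathsf{Act},\rightarrow,\uparrow)$ with ${\rightarrow}\subseteq\mathrm{Proc}\times\mathsf{Act}\times\mathrm{Proc}$ (written $p\xrightarrow{a}q$), ${\uparrow}\subseteq\mathrm{Proc}$; $p\downarrow$ means not $p\uparrow$. $\mathrm{HML}^+$: formulas built from atomic formulas $\mathsf{init}(A)$ ($A$ a finite subset of $\mathsf{Act}$) by finite conjunctions, finite disjunctions, $[a]\phi$ and $\langle a\rangle\phi$ ($a\in\mathsf{Act}$). Satisfaction: $p\models\mathsf{init}(A)$ iff $p\downarrow$ and $\{a:\exists q.\,p\xrightarrow{a}q\}\subseteq A$; $p\models\langle a\rangle\phi$ iff $\exists q.\,p\xrightarrow{a}q\wedge q\models\phi$; $p\models[a]\phi$ iff $p\downarrow$ and every $q$ with $p\xrightarrow{a}q$ satisfies $\phi$; connectives as usual. $\mathrm{HML}^+(p)$ = formulas satisfied by $p$. $\mathcal{L}_\omega$: sorts $\pi,\kappa$; finite conjunctions/disjunctions within a sort; $a(\phi)$ of sort $\kappa$ for $\phi$ of sort $\pi$; $\Box\phi,\Diamond\phi$ of sort $\pi$ for $\phi$ of sort $\kappa$. With $C(p)=\{\bot:p\uparrow\}\cup\{\langle a,q\rangle:p\xrightarrow{a}q\}$: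 $p\models\Box\phi$ iff all $c\in C(p)$ satisfy $\phi$; $p\models\Diamond\phi$ iff some $c\in C(p)\cup\{\bot\}$ satisfies $\phi$; $c\models a(\phi)$ iff $c=\langle a,q\rangle$ with $q\models\phi$; infinite conjunctions/disjunctions interpreted as usual. $\mathcal{L}_\omega(p)$ = sort-$\pi$ formulas of $\mathcal{L}_\omega$ satisfied by $p$. (BN): for every set $I$ and sort-$\kappa$ formulas $\phi_i\in\mathcal{L}_\omega$, every process satisfying $\Box\bigvee_{i\in I}\phi_i$ satisfies $\bigvee_{J}\Box\bigvee_{j\in J}\phi_j$, $J$ ranging over finite subsets of $I$. *)

theory Defs
  imports Main "HOL-Library.FSet"
begin

record ('p, 'a) transition_structure =
  Proc :: "'p set"
  Act :: "'a set"
  Trans :: "('p \<times> 'a \<times> 'p) set"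
  Diverging :: "'p set"

definition transition_system :: "('p, 'a, 'z) transition_structure_scheme \<Rightarrow> bool" where
  "transition_system S \<longleftrightarrow>
     Trans S \<subseteq> Proc S \<times> Act S \<times> Proc S \<and> Diverging S \<subseteq> Proc S"

definition converges :: "('p, 'a, 'z) transition_structure_scheme \<Rightarrow> 'p \<Rightarrow> bool" where
  "converges S p \<longleftrightarrow> p \<notin> Diverging S"


(* Finite conjunctions and disjunctions are taken over lists of formulas; the empty list gives
   truth and falsity.  The set functions hml_actions, pi_actions and kappa_actions of the
   datatypes below collect the actions occurring in a formula. *)

datatype (hml_actions: 'a) hml =
    HInit "'a fset"
  | HConj "'a hml list"
  | HDisj "'a hml list"
  | HBox 'a "'a hml"
  | HDia 'a "'a hml"

fun hml_sat :: "('p, 'a, 'z) transition_structure_scheme \<Rightarrow> 'p \<Rightarrow> 'a hml \<Rightarrow> bool" where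
  "hml_sat S p (HInit A) \<longleftrightarrow> converges S p \<and> {a. \<exists>q. (p, a, q) \<in> Trans S} \<subseteq> fset A"
| "hml_sat S p (HConj \<phi>s) \<longleftrightarrow> (\<forall>\<phi>\<in>set \<phi>s. hml_sat S p \<phi>)"
| "hml_sat S p (HDisj \<phi>s) \<longleftrightarrow> (\<exists>\<phi>\<in>set \<phi>s. hml_sat S p \<phi>)"
| "hml_sat S p (HBox a \<phi>) \<longleftrightarrow> converges S p \<and> (\<forall>q. (p, a, q) \<in> Trans S \<longrightarrow> hml_sat S q \<phi>)"
| "hml_sat S p (HDia a \<phi>) \<longleftrightarrow> (\<exists>q. (p, a, q) \<in> Trans S \<and> hml_sat S q \<phi>)"

definition HML_plus :: "('p, 'a, 'z) transition_structure_scheme \<Rightarrow> 'p \<Rightarrow> 'a hml set" where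
  "HML_plus S p = {\<phi>. hml_actions \<phi> \<subseteq> Act S \<and> hml_sat S p \<phi>}"


datatype (pi_actions: 'a) pi_form =
    PConj "'a pi_form list"
  | PDisj "'a pi_form list"
  | Box "'a kappa_form"
  | Dia "'a kappa_form"
and (kappa_actions: 'a) kappa_form =
    KConj "'a kappa_form list"
  | KDisj "'a kappa_form list"
  | KAct 'a "'a pi_form"

datatype ('a, 'p) capability = Bot | Step 'a 'p

definition C :: "('p, 'a, 'z) transition_structure_scheme \<Rightarrow> 'p \<Rightarrow> ('a, 'p) capability set" where
  "C S p = {c. c = Bot \<and> p \<in> Diverging S} \<union> {Step a q |a q. (p, a, q) \<in> Trans S}"

(* The modalities on arbitrary predicates of capabilities, so that Box can also be applied to
   the infinite disjunctions occurring in (BN). *)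

definition box :: "('p, 'a, 'z) transition_structure_scheme \<Rightarrow> 'p \<Rightarrow>
    (('a, 'p) capability \<Rightarrow> bool) \<Rightarrow> bool" where
  "box S p K \<longleftrightarrow> (\<forall>c\<in>C S p. K c)"

definition dia :: "('p, 'a, 'z) transition_structure_scheme \<Rightarrow> 'p \<Rightarrow>
    (('a, 'p) capability \<Rightarrow> bool) \<Rightarrow> bool" where
  "dia S p K \<longleftrightarrow> (\<exists>c\<in>C S p \<union> {Bot}. K c)"

lemma box_cong [fundef_cong]:
  "S = S' \<Longrightarrow> p = p' \<Longrightarrow> (\<And>c. K c = K' c) \<Longrightarrow> box S p K = box S' p' K'"
  by (simp add: box_def)

lemma dia_cong [fundef_cong]:
  "S = S' \<Longrightarrow> p = p' \<Longrightarrow> (\<And>c. K c = K' c) \<Longrightarrow> dia S p K = dia S' p' K'"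
  by (simp add: dia_def)

fun pi_sat :: "('p, 'a, 'z) transition_structure_scheme \<Rightarrow> 'p \<Rightarrow> 'a pi_form \<Rightarrow> bool"
  and kappa_sat :: "('p, 'a, 'z) transition_structure_scheme \<Rightarrow> ('a, 'p) capability \<Rightarrow>
    'a kappa_form \<Rightarrow> bool" where
  "pi_sat S p (PConj \<phi>s) \<longleftrightarrow> (\<forall>\<phi>\<in>set \<phi>s. pi_sat S p \<phi>)"
| "pi_sat S p (PDisj \<phi>s) \<longleftrightarrow> (\<exists>\<phi>\<in>set \<phi>s. pi_sat S p \<phi>)"
| "pi_sat S p (Box \<phi>) \<longleftrightarrow> box S p (\<lambda>c. kappa_sat S c \<phi>)"
| "pi_sat S p (Dia \<phi>) \<longleftrightarrow> dia S p (\<lambda>c. kappa_sat S c \<phi>)"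
| "kappa_sat S c (KConj \<phi>s) \<longleftrightarrow> (\<forall>\<phi>\<in>set \<phi>s. kappa_sat S c \<phi>)"
| "kappa_sat S c (KDisj \<phi>s) \<longleftrightarrow> (\<exists>\<phi>\<in>set \<phi>s. kappa_sat S c \<phi>)"
| "kappa_sat S c (KAct a \<phi>) \<longleftrightarrow> (\<exists>q. c = Step a q \<and> pi_sat S q \<phi>)"

definition L_omega :: "('p, 'a, 'z) transition_structure_scheme \<Rightarrow> 'p \<Rightarrow> 'a pi_form set" where
  "L_omega S p = {\<phi>. pi_actions \<phi> \<subseteq> Act S \<and> pi_sat S p \<phi>}"


(* Families of sort-kappa formulas are represented by their ranges, which avoids fixing a type
   of indices; BN_family recovers families over an arbitrary index type. *)

definition BN :: "('p, 'a, 'z) transition_structure_scheme \<Rightarrow> bool" where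
  "BN S \<longleftrightarrow>
     (\<forall>\<Phi>. (\<forall>\<phi>\<in>\<Phi>. kappa_actions \<phi> \<subseteq> Act S) \<longrightarrow>
       (\<forall>p\<in>Proc S. box S p (\<lambda>c. \<exists>\<phi>\<in>\<Phi>. kappa_sat S c \<phi>) \<longrightarrow>
         (\<exists>J. finite J \<and> J \<subseteq> \<Phi> \<and> box S p (\<lambda>c. \<exists>\<phi>\<in>J. kappa_sat S c \<phi>))))"

lemma BN_family:
  fixes I :: "'i set" and \<phi> :: "'i \<Rightarrow> 'a kappa_form"
  assumes "BN S" and "\<And>i. i \<in> I \<Longrightarrow> kappa_actions (\<phi> i) \<subseteq> Act S" and "p \<in> Proc S"
    and "box S p (\<lambda>c. \<exists>i\<in>I. kappa_sat S c (\<phi> i))"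
  shows "\<exists>J. finite J \<and> J \<subseteq> I \<and> box S p (\<lambda>c. \<exists>j\<in>J. kappa_sat S c (\<phi> j))"
proof -
  have "\<forall>\<psi>\<in>\<phi> ` I. kappa_actions \<psi> \<subseteq> Act S"
    and "box S p (\<lambda>c. \<exists>\<psi>\<in>\<phi> ` I. kappa_sat S c \<psi>)"
    using assms(2,4) by auto
  then obtain K where K: "finite K" "K \<subseteq> \<phi> ` I" "box S p (\<lambda>c. \<exists>\<psi>\<in>K. kappa_sat S c \<psi>)"
    using assms(1,3) unfolding BN_def by meson
  from K(1,2) obtain J where "J \<subseteq> I" "finite J" "K = \<phi> ` J"
    by (meson finite_subset_image)
  with K(3) show ?thesis by auto
qed

end

(* Only finitely many actions can occur at the top of a sort-kappa formula that fails at Bot, so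
   such a formula is a finite disjunction of formulas a(phi), and its Box is
   init(A) together with one [a]phi for each a in A.  Hence every L_omega formula is equivalent to
   an HML+ formula, in any transition system.  Conversely [a]phi is Box of the infinite disjunction
   of a(psi), for the L_omega formulas psi entailing phi, and of b(true), for b distinct from a;
   by (BN) a finite part of it already holds at a given process.  So HML+ formulas are equivalent
   to possibly infinite disjunctions of L_omega formulas. *)

theory Submission
  imports Defs
begin

text \<open>Formulas of sort kappa are built positively from atoms \<open>KAct\<close>, all false at
  \<open>Bot\<close>. Hence truth at \<open>Bot\<close> comes from the connectives alone and carries
  over to every capability.\<close>

lemma kappa_sat_Bot: "kappa_sat S Bot \<psi> \<Longrightarrow> kappa_sat S c \<psi>"
proof (induction \<psi> rule: kappa_form.induct[where ?P1.0 = "\<lambda>_. True"])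
qed auto

text \<open>By positivity, truth at a step but not at \<open>Bot\<close> requires some atom to hold
  at the step, and its label is the action of the step.\<close>

lemma kappa_sat_Step_action:
  "kappa_sat S (Step a q) \<psi> \<Longrightarrow> kappa_sat S Bot \<psi> \<or> a \<in> kappa_actions \<psi>"
proof (induction \<psi> rule: kappa_form.induct[where ?P1.0 = "\<lambda>_. True"])
qed auto

lemma finite_kappa_actions: "finite (kappa_actions \<psi>)"
proof (induction \<psi> rule: kappa_form.induct[where ?P1.0 = "\<lambda>\<phi>. finite (pi_actions \<phi>)"])
qed auto

text \<open>Failure at \<open>Bot\<close> turns the box into a convergence condition, and only steps
  labelled in the finite set \<open>kappa_actions \<psi>\<close> can satisfy \<open>\<psi>\<close>.
  The right-hand side thus has the shape of one \<open>HInit\<close> and finitely many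
  \<open>HBox\<close>.\<close>

lemma pi_sat_Box_iff:
  assumes "\<not> kappa_sat S Bot \<psi>"
  shows "pi_sat S p (Box \<psi>) \<longleftrightarrow>
    converges S p \<and> {a. \<exists>q. (p, a, q) \<in> Trans S} \<subseteq> kappa_actions \<psi> \<and>
    (\<forall>a\<in>kappa_actions \<psi>. \<forall>q. (p, a, q) \<in> Trans S \<longrightarrow> kappa_sat S (Step a q) \<psi>)"
  using assms kappa_sat_Step_action[of S _ _ \<psi>]
  by (fastforce simp: box_def C_def converges_def)

lemma pi_sat_Dia_iff:
  assumes "\<not> kappa_sat S Bot \<psi>"
  shows "pi_sat S p (Dia \<psi>) \<longleftrightarrow>
    (\<exists>a\<in>kappa_actions \<psi>. \<exists>q. (p, a, q) \<in> Trans S \<and> kappa_sat S (Step a q) \<psi>)"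
  using assms kappa_sat_Step_action[of S _ _ \<psi>]
  by (fastforce simp: dia_def C_def)

text \<open>A formula of sort kappa speaks of capabilities, so the simultaneous induction translates
  its residual at each action \<open>a\<close>: the condition on \<open>q\<close> under which
  \<open>Step a q\<close> satisfies it.\<close>

lemma pi_form_equivalent_hml:
  assumes "pi_actions \<phi> \<subseteq> Act S"
  shows "\<exists>h. hml_actions h \<subseteq> Act S \<and> (\<forall>p. hml_sat S p h \<longleftrightarrow> pi_sat S p \<phi>)"
proof -
  have modal: "(\<exists>h. hml_actions h \<subseteq> Act S \<and> (\<forall>p. hml_sat S p h \<longleftrightarrow> pi_sat S p (Box \<psi>))) \<and>
      (\<exists>h. hml_actions h \<subseteq> Act S \<and> (\<forall>p. hml_sat S p h \<longleftrightarrow> pi_sat S p (Dia \<psi>)))"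
    if IH: "\<forall>a. \<exists>h. hml_actions h \<subseteq> Act S \<and> (\<forall>q. hml_sat S q h \<longleftrightarrow> kappa_sat S (Step a q) \<psi>)"
      and act: "kappa_actions \<psi> \<subseteq> Act S" for \<psi>
  proof (cases "kappa_sat S Bot \<psi>")
    case True
    then have "kappa_sat S c \<psi>" for c by (rule kappa_sat_Bot)
    then have "hml_sat S p (HConj [])" "pi_sat S p (Box \<psi>)" "pi_sat S p (Dia \<psi>)" for p
      by (auto simp: box_def dia_def)
    moreover have "hml_actions (HConj []) \<subseteq> Act S" by simp
    ultimately show ?thesis by blast
  next
    case False
    from choice[OF IH] obtain h where h: "\<And>a. hml_actions (h a) \<subseteq> Act S"
      "\<And>a q. hml_sat S q (h a) \<longleftrightarrow> kappa_sat S (Step a q) \<psi>" by auto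
    obtain as where as: "set as = kappa_actions \<psi>"
      using finite_list[OF finite_kappa_actions[of \<psi>]] by auto
    \<comment> \<open>The \<open>HInit\<close> conjunct still enforces convergence when
      \<open>as\<close> is empty and no \<open>HBox\<close> occurs.\<close>
    have "\<forall>p. hml_sat S p (HConj (HInit (fset_of_list as) # map (\<lambda>a. HBox a (h a)) as))
        \<longleftrightarrow> pi_sat S p (Box \<psi>)"
      unfolding pi_sat_Box_iff[OF False] by (auto simp: h(2) as fset_of_list.rep_eq)
    moreover have "\<forall>p. hml_sat S p (HDisj (map (\<lambda>a. HDia a (h a)) as)) \<longleftrightarrow> pi_sat S p (Dia \<psi>)"
      unfolding pi_sat_Dia_iff[OF False] by (auto simp: h(2) as)
    moreover have "hml_actions (HConj (HInit (fset_of_list as) # map (\<lambda>a. HBox a (h a)) as)) \<subseteq> Act S"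
      "hml_actions (HDisj (map (\<lambda>a. HDia a (h a)) as)) \<subseteq> Act S"
      using act h(1) as by (auto simp: fset_of_list.rep_eq)
    ultimately show ?thesis by blast
  qed
  show ?thesis using assms
  proof (induction \<phi> rule: pi_form.induct[where ?P2.0 = "\<lambda>\<psi>. kappa_actions \<psi> \<subseteq> Act S \<longrightarrow>
      (\<forall>a. \<exists>h. hml_actions h \<subseteq> Act S \<and> (\<forall>q. hml_sat S q h \<longleftrightarrow> kappa_sat S (Step a q) \<psi>))"])
    case (PConj \<phi>s)
    then have "\<forall>\<phi>\<in>set \<phi>s. \<exists>h. hml_actions h \<subseteq> Act S \<and> (\<forall>p. hml_sat S p h \<longleftrightarrow> pi_sat S p \<phi>)"
      by (simp add: UN_subset_iff)
    from bchoice[OF this] obtain h where "\<forall>\<phi>\<in>set \<phi>s. hml_actions (h \<phi>) \<subseteq> Act S \<and>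
        (\<forall>p. hml_sat S p (h \<phi>) \<longleftrightarrow> pi_sat S p \<phi>)" by blast
    then show ?case by (intro exI[of _ "HConj (map h \<phi>s)"]) auto
  next
    case (PDisj \<phi>s)
    then have "\<forall>\<phi>\<in>set \<phi>s. \<exists>h. hml_actions h \<subseteq> Act S \<and> (\<forall>p. hml_sat S p h \<longleftrightarrow> pi_sat S p \<phi>)"
      by (simp add: UN_subset_iff)
    from bchoice[OF this] obtain h where "\<forall>\<phi>\<in>set \<phi>s. hml_actions (h \<phi>) \<subseteq> Act S \<and>
        (\<forall>p. hml_sat S p (h \<phi>) \<longleftrightarrow> pi_sat S p \<phi>)" by blast
    then show ?case by (intro exI[of _ "HDisj (map h \<phi>s)"]) auto
  next
    case (Box \<psi>)
    then show ?case using modal[of \<psi>] by simp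
  next
    case (Dia \<psi>)
    then show ?case using modal[of \<psi>] by simp
  next
    case (KConj \<psi>s)
    show ?case
    proof (intro impI allI)
      fix a
      assume "kappa_actions (KConj \<psi>s) \<subseteq> Act S"
      with KConj have "\<forall>\<psi>\<in>set \<psi>s. \<exists>h. hml_actions h \<subseteq> Act S \<and>
          (\<forall>q. hml_sat S q h \<longleftrightarrow> kappa_sat S (Step a q) \<psi>)"
        by (simp add: UN_subset_iff)
      from bchoice[OF this] obtain h where "\<forall>\<psi>\<in>set \<psi>s. hml_actions (h \<psi>) \<subseteq> Act S \<and>
          (\<forall>q. hml_sat S q (h \<psi>) \<longleftrightarrow> kappa_sat S (Step a q) \<psi>)" by blast
      then show "\<exists>h. hml_actions h \<subseteq> Act S \<and>
          (\<forall>q. hml_sat S q h \<longleftrightarrow> kappa_sat S (Step a q) (KConj \<psi>s))"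
        by (intro exI[of _ "HConj (map h \<psi>s)"]) auto
    qed
  next
    case (KDisj \<psi>s)
    show ?case
    proof (intro impI allI)
      fix a
      assume "kappa_actions (KDisj \<psi>s) \<subseteq> Act S"
      with KDisj have "\<forall>\<psi>\<in>set \<psi>s. \<exists>h. hml_actions h \<subseteq> Act S \<and>
          (\<forall>q. hml_sat S q h \<longleftrightarrow> kappa_sat S (Step a q) \<psi>)"
        by (simp add: UN_subset_iff)
      from bchoice[OF this] obtain h where "\<forall>\<psi>\<in>set \<psi>s. hml_actions (h \<psi>) \<subseteq> Act S \<and>
          (\<forall>q. hml_sat S q (h \<psi>) \<longleftrightarrow> kappa_sat S (Step a q) \<psi>)" by blast
      then show "\<exists>h. hml_actions h \<subseteq> Act S \<and>
          (\<forall>q. hml_sat S q h \<longleftrightarrow> kappa_sat S (Step a q) (KDisj \<psi>s))"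
        by (intro exI[of _ "HDisj (map h \<psi>s)"]) auto
    qed
  next
    case (KAct b \<phi>)
    show ?case
    proof (intro impI allI)
      fix a
      assume "kappa_actions (KAct b \<phi>) \<subseteq> Act S"
      with KAct obtain h where "hml_actions h \<subseteq> Act S" "\<forall>p. hml_sat S p h \<longleftrightarrow> pi_sat S p \<phi>"
        by auto
      then show "\<exists>h. hml_actions h \<subseteq> Act S \<and>
          (\<forall>q. hml_sat S q h \<longleftrightarrow> kappa_sat S (Step a q) (KAct b \<phi>))"
        \<comment> \<open>For an action other than \<open>b\<close> the residual is falsity, the
          empty disjunction.\<close>
        by (intro exI[of _ "if a = b then h else HDisj []"]) auto
    qed
  qed
qed

text \<open>The formula may depend on \<open>p\<close>, since (BN) picks its finite part at
  \<open>p\<close>. Entailment is nevertheless required at every \<open>r\<close>, so that in the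
  box case it can be applied to the successors of an arbitrary state.\<close>

lemma hml_sat_imp_entailing_pi_form:
  assumes "transition_system S" and "BN S"
    and "p \<in> Proc S" and "hml_sat S p h" and "hml_actions h \<subseteq> Act S"
  shows "\<exists>\<phi>. pi_actions \<phi> \<subseteq> Act S \<and> pi_sat S p \<phi> \<and> (\<forall>r. pi_sat S r \<phi> \<longrightarrow> hml_sat S r h)"
proof -
  have step: "a \<in> Act S \<and> q \<in> Proc S" if "(p, a, q) \<in> Trans S" for p a q
    using assms(1) that by (auto simp: transition_system_def)
  show ?thesis using assms(3-5)
  proof (induction h arbitrary: p)
    case (HInit A)
    obtain as where as: "set as = fset A" using finite_list[OF finite_fset[of A]] by auto
    show ?case
    proof (intro exI conjI)
      show "pi_actions (Box (KDisj (map (\<lambda>a. KAct a (PConj [])) as))) \<subseteq> Act S"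
        using HInit.prems as by auto
      show "pi_sat S p (Box (KDisj (map (\<lambda>a. KAct a (PConj [])) as)))"
        using HInit.prems by (auto simp: box_def C_def converges_def as)
      show "\<forall>r. pi_sat S r (Box (KDisj (map (\<lambda>a. KAct a (PConj [])) as))) \<longrightarrow>
          hml_sat S r (HInit A)"
        by (fastforce simp: box_def C_def converges_def as)
    qed
  next
    case (HConj hs)
    then have "\<forall>h\<in>set hs. \<exists>\<phi>. pi_actions \<phi> \<subseteq> Act S \<and> pi_sat S p \<phi> \<and>
        (\<forall>r. pi_sat S r \<phi> \<longrightarrow> hml_sat S r h)"
      by (simp add: UN_subset_iff)
    from bchoice[OF this] obtain f where "\<forall>h\<in>set hs. pi_actions (f h) \<subseteq> Act S \<and> pi_sat S p (f h) \<and>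
        (\<forall>r. pi_sat S r (f h) \<longrightarrow> hml_sat S r h)" by blast
    then show ?case by (intro exI[of _ "PConj (map f hs)"]) auto
  next
    case (HDisj hs)
    then obtain h where h: "h \<in> set hs" "hml_sat S p h" by auto
    with HDisj.prems have "hml_actions h \<subseteq> Act S" by auto
    from HDisj.IH[OF h(1) HDisj.prems(1) h(2) this] h(1) show ?case by auto
  next
    case (HBox a h)
    \<comment> \<open>\<open>Box\<close> constrains every capability but \<open>HBox a\<close> only
      the steps labelled \<open>a\<close>; the members \<open>KAct b (PConj [])\<close> let all
      other steps pass.\<close>
    define \<Phi> where "\<Phi> = {KAct a \<phi> |\<phi>. pi_actions \<phi> \<subseteq> Act S \<and>
        (\<forall>r. pi_sat S r \<phi> \<longrightarrow> hml_sat S r h)} \<union> {KAct b (PConj []) |b. b \<in> Act S \<and> b \<noteq> a}"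
    have \<Phi>_act: "\<forall>\<psi>\<in>\<Phi>. kappa_actions \<psi> \<subseteq> Act S"
      using HBox.prems by (auto simp: \<Phi>_def)
    have "\<exists>\<psi>\<in>\<Phi>. kappa_sat S (Step b q) \<psi>" if tr: "(p, b, q) \<in> Trans S" for b q
    proof (cases "b = a")
      case True
      have "q \<in> Proc S" "hml_sat S q h" "hml_actions h \<subseteq> Act S"
        using HBox.prems tr step True by auto
      from HBox.IH[OF this] obtain \<phi> where
        "pi_actions \<phi> \<subseteq> Act S" "pi_sat S q \<phi>" "\<forall>r. pi_sat S r \<phi> \<longrightarrow> hml_sat S r h" by blast
      then have "KAct a \<phi> \<in> \<Phi>" "kappa_sat S (Step b q) (KAct a \<phi>)"
        using True by (auto simp: \<Phi>_def)
      then show ?thesis by blast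
    next
      case False
      then have "KAct b (PConj []) \<in> \<Phi>" "kappa_sat S (Step b q) (KAct b (PConj []))"
        using step[OF tr] by (auto simp: \<Phi>_def)
      then show ?thesis by blast
    qed
    \<comment> \<open>\<open>HBox a h\<close> at \<open>p\<close> includes convergence, so
      \<open>Bot\<close> is not among the capabilities to be covered.\<close>
    then have "box S p (\<lambda>c. \<exists>\<psi>\<in>\<Phi>. kappa_sat S c \<psi>)"
      using HBox.prems by (auto simp: box_def C_def converges_def)
    then obtain J where J: "finite J" "J \<subseteq> \<Phi>" "box S p (\<lambda>c. \<exists>\<psi>\<in>J. kappa_sat S c \<psi>)"
      using assms(2) \<Phi>_act HBox.prems(1) unfolding BN_def by meson
    obtain js where js: "set js = J" using finite_list[OF J(1)] by blast
    show ?case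
    proof (intro exI conjI allI impI)
      show "pi_actions (Box (KDisj js)) \<subseteq> Act S" using \<Phi>_act J(2) js by auto
      show "pi_sat S p (Box (KDisj js))" using J(3) js by simp
      fix r
      assume "pi_sat S r (Box (KDisj js))"
      then have r: "\<exists>\<psi>\<in>\<Phi>. kappa_sat S c \<psi>" if "c \<in> C S r" for c
        using that J(2) js by (auto simp: box_def)
      \<comment> \<open>As every member of \<open>\<Phi>\<close> is a single atom, the box excludes
        \<open>Bot\<close> from \<open>C S r\<close>.\<close>
      have "\<not> kappa_sat S Bot \<psi>" if "\<psi> \<in> \<Phi>" for \<psi> using that by (auto simp: \<Phi>_def)
      then have "converges S r" using r[of Bot] by (auto simp: C_def converges_def)
      \<comment> \<open>A step labelled \<open>a\<close> can only satisfy a member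
        \<open>KAct a \<phi>\<close>, whose \<open>\<phi>\<close> entails \<open>h\<close>.\<close>
      moreover have "hml_sat S q h" if "(r, a, q) \<in> Trans S" for q
        using r[of "Step a q"] that by (auto simp: C_def \<Phi>_def)
      ultimately show "hml_sat S r (HBox a h)" by simp
    qed
  next
    case (HDia a h)
    then obtain q where q: "(p, a, q) \<in> Trans S" "hml_sat S q h" by auto
    with HDia.IH[of q] HDia.prems step[OF q(1)] obtain \<phi> where
      "pi_actions \<phi> \<subseteq> Act S" "pi_sat S q \<phi>" "\<forall>r. pi_sat S r \<phi> \<longrightarrow> hml_sat S r h" by auto
    \<comment> \<open>The extra \<open>Bot\<close> allowed by \<open>Dia\<close> is harmless,
      because an atom fails there.\<close>
    then show ?case using q(1) step[OF q(1)]
      by (intro exI[of _ "Dia (KAct a \<phi>)"]) (auto simp: dia_def C_def)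
  qed
qed

theorem mainTheorem10:
  fixes S :: "('p, 'a) transition_structure"
  assumes "transition_system S" and "BN S"
    and "p \<in> Proc S" and "q \<in> Proc S"
  shows "HML_plus S p \<subseteq> HML_plus S q \<longleftrightarrow> L_omega S p \<subseteq> L_omega S q"
proof
  assume sub: "HML_plus S p \<subseteq> HML_plus S q"
  show "L_omega S p \<subseteq> L_omega S q"
  proof
    fix \<phi>
    assume "\<phi> \<in> L_omega S p"
    then have "pi_actions \<phi> \<subseteq> Act S" "pi_sat S p \<phi>" by (auto simp: L_omega_def)
    with pi_form_equivalent_hml[of \<phi> S] sub show "\<phi> \<in> L_omega S q"
      unfolding L_omega_def HML_plus_def by blast
  qed
next
  assume sub: "L_omega S p \<subseteq> L_omega S q"
  show "HML_plus S p \<subseteq> HML_plus S q"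
  proof
    fix h
    assume "h \<in> HML_plus S p"
    then have "hml_sat S p h" "hml_actions h \<subseteq> Act S" by (auto simp: HML_plus_def)
    \<comment> \<open>The formula found at \<open>p\<close> is transferred to \<open>q\<close> by
      the inclusion and entails \<open>h\<close> there.\<close>
    with hml_sat_imp_entailing_pi_form[OF assms(1-3)] sub show "h \<in> HML_plus S q"
      unfolding L_omega_def HML_plus_def by blast
  qed
qed

end
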